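(* Let $(\mathcal{E},\mathcal{F})$ be a semi-duality and $G$ a group of weakly continuous endomorphisms of $\mathcal{E}$. A Kreĭn subspace $\mathcal{K}$ of $\mathcal{E}$, with kernel $K$ and minimal bound $H$, is invariant under $G$ if and only if 1. $gKg^*=K$ for all $g\in G$, and 2. for every $g\in G$ there exists $\alpha_g$ such that $gHg^*\le\alpha_gH$.
   Context: A Kreĭn space is a space $\mathcal{K}$ with a Hermitian sesquilinear form $[\cdot,\cdot]$ admitting a fundamental symmetry $J$ ($J^2=I$, $\langle x,y\rangle=[Jx,y]$ a Hilbert inner product); its topology is that of any such Hilbert norm. A semi-duality $(\mathcal{E},\mathcal{F})$ is a pair of spaces with a non-degenerate sesquilinear form $(\cdot,\cdot)_{(\mathcal{F},\mathcal{E})}$ ($\mathcal{F}$ is identified with the continuous semilinear forms on $\mathcal{E}$). A kernel is a weakly continuous linear map $\varkappa:\mathcal{F}\to\mathcal{E}$; its adjoint $\varkappa^*$ is again a kernel; it is Hermitian if $\varkappa^*=\varkappa$, positive if $(\varphi,\varkappa(\varphi))\ge0$ for all $\varphi\in\mathcal{F}$; $H\le K$ means $K-H$ is positive. Positive kernels $A,B$ are independent if any kernel $C$ with $0\le C\le A$, $0\le C\le B$ is $0$. $(K,H)$ is a minimal pair if $K$ is Hermitian, $H$ is positive, $-H\le K\le H$, and $H-K$, $H+K$ are independent. A weakly continuous $g:\mathcal{E}\to\mathcal{E}$ has adjoint $g^*:\mathcal{F}\to\mathcal{F}$. A Hilbert (Kreĭn) subspace of $\mathcal{E}$ is a Hilbert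 (Kreĭn) space continuously included in $\mathcal{E}$ for Mackey topologies; its kernel $K$ is characterized by $[K(\varphi),k]_{\mathcal{K}}=(\varphi,k)$ for all $\varphi\in\mathcal{F}$, $k\in\mathcal{K}$ (similarly for Hilbert subspaces). "Minimal bound $H$" of $\mathcal{K}$: $H$ is the kernel of a Hilbert subspace $\mathcal{H}$ such that $(\mathcal{K},\mathcal{H})$ is a minimal Kreĭn–Hilbert pair, i.e. $\mathcal{K}=\mathcal{H}_+\ominus\mathcal{H}_-$ and $\mathcal{H}=\mathcal{H}_+\oplus\mathcal{H}_-$ for two Hilbert subspaces $\mathcal{H}_\pm$ (so $\mathcal{H}=\mathcal{K}$ as vector spaces, and $(K,H)$ is a minimal pair of kernels). $\mathcal{K}$ is invariant under $G$ if $g(\mathcal{K})\subset\mathcal{K}$ and $gKg^*=K$ for all $g\in G$. *)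

theory Defs
  imports "HOL-Analysis.Analysis" "HOL-Algebra.Group"
begin

text \<open>
  The form is linear in its first and conjugate-linear in its second argument, so that \<open>'f\<close>
  consists of semilinear forms on \<open>'e\<close>.
\<close>

locale semi_duality = E: vector_space sE + F: vector_space sF
  for sE :: "complex \<Rightarrow> 'e::ab_group_add \<Rightarrow> 'e"
    and sF :: "complex \<Rightarrow> 'f::ab_group_add \<Rightarrow> 'f" +
  fixes pair :: "'f \<Rightarrow> 'e \<Rightarrow> complex"
  assumes pair_add_left: "pair (\<phi> + \<psi>) x = pair \<phi> x + pair \<psi> x"
    and pair_scale_left: "pair (sF c \<phi>) x = c * pair \<phi> x"
    and pair_add_right: "pair \<phi> (x + y) = pair \<phi> x + pair \<phi> y"
    and pair_scale_right: "pair \<phi> (sE c x) = cnj c * pair \<phi> x"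
    and nondegenerate_left: "(\<And>x. pair \<phi> x = 0) \<Longrightarrow> \<phi> = 0"
    and nondegenerate_right: "(\<And>\<phi>. pair \<phi> x = 0) \<Longrightarrow> x = 0"


section \<open>Weak and Mackey topologies\<close>

definition initial_topology :: "('a \<Rightarrow> complex) set \<Rightarrow> 'a topology" where
  "initial_topology fs = topology_generated_by {f -` U |f U. f \<in> fs \<and> open U}"

definition weak_E :: "('f \<Rightarrow> 'e \<Rightarrow> complex) \<Rightarrow> 'e topology" where
  "weak_E pair = initial_topology (range pair)"

definition weak_F :: "('f \<Rightarrow> 'e \<Rightarrow> complex) \<Rightarrow> 'f topology" where
  "weak_F pair = initial_topology (range (\<lambda>x \<phi>. pair \<phi> x))"

definition absolutely_convex :: "(complex \<Rightarrow> 'f::ab_group_add \<Rightarrow> 'f) \<Rightarrow> 'f set \<Rightarrow> bool" where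
  "absolutely_convex sF C \<longleftrightarrow>
     (\<forall>\<phi>\<in>C. \<forall>\<psi>\<in>C. \<forall>a b. cmod a + cmod b \<le> 1 \<longrightarrow> sF a \<phi> + sF b \<psi> \<in> C)"

text \<open>
  The topology on \<open>'e\<close> of uniform convergence on the weakly compact absolutely convex subsets
  of \<open>'f\<close>.  As \<open>C\<close> is compact, the sets below are exactly the open balls of the seminorms
  \<open>y \<mapsto> sup {cmod (pair \<phi> y) |\<phi>. \<phi> \<in> C}\<close>.
\<close>

definition mackey_E ::
  "(complex \<Rightarrow> 'f::ab_group_add \<Rightarrow> 'f) \<Rightarrow> ('f \<Rightarrow> 'e::ab_group_add \<Rightarrow> complex) \<Rightarrow> 'e topology" where
  "mackey_E sF pair = topology_generated_by
     {{y. \<forall>\<phi>\<in>C. cmod (pair \<phi> (y - x)) < r} |x C r.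
        compactin (weak_F pair) C \<and> absolutely_convex sF C \<and> 0 < r}"


section \<open>Endomorphisms and kernels\<close>

definition weak_endomorphism ::
  "(complex \<Rightarrow> 'e::ab_group_add \<Rightarrow> 'e) \<Rightarrow> ('f \<Rightarrow> 'e \<Rightarrow> complex) \<Rightarrow> ('e \<Rightarrow> 'e) \<Rightarrow> bool" where
  "weak_endomorphism sE pair g \<longleftrightarrow>
     Vector_Spaces.linear sE sE g \<and> continuous_map (weak_E pair) (weak_E pair) g"

definition weak_End ::
  "(complex \<Rightarrow> 'e::ab_group_add \<Rightarrow> 'e) \<Rightarrow> ('f \<Rightarrow> 'e \<Rightarrow> complex) \<Rightarrow> ('e \<Rightarrow> 'e) monoid" where
  "weak_End sE pair = \<lparr>carrier = {g. weak_endomorphism sE pair g}, mult = (\<circ>), one = id\<rparr>"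

text \<open>Meaningful for weakly continuous linear \<open>g\<close>, where \<open>\<psi>\<close> exists and is unique.\<close>

definition weak_adjoint :: "('f \<Rightarrow> 'e \<Rightarrow> complex) \<Rightarrow> ('e \<Rightarrow> 'e) \<Rightarrow> 'f \<Rightarrow> 'f" where
  "weak_adjoint pair g \<phi> = (THE \<psi>. \<forall>x. pair \<psi> x = pair \<phi> (g x))"

definition kernel ::
  "(complex \<Rightarrow> 'e::ab_group_add \<Rightarrow> 'e) \<Rightarrow> (complex \<Rightarrow> 'f::ab_group_add \<Rightarrow> 'f) \<Rightarrow>
   ('f \<Rightarrow> 'e \<Rightarrow> complex) \<Rightarrow> ('f \<Rightarrow> 'e) \<Rightarrow> bool" where
  "kernel sE sF pair k \<longleftrightarrow>
     Vector_Spaces.linear sF sE k \<and> continuous_map (weak_F pair) (weak_E pair) k"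

definition kernel_positive :: "('f \<Rightarrow> 'e \<Rightarrow> complex) \<Rightarrow> ('f \<Rightarrow> 'e) \<Rightarrow> bool" where
  "kernel_positive pair k \<longleftrightarrow> (\<forall>\<phi>. pair \<phi> (k \<phi>) \<in> \<real>\<^sub>\<ge>\<^sub>0)"

definition kernel_le ::
  "('f \<Rightarrow> 'e::ab_group_add \<Rightarrow> complex) \<Rightarrow> ('f \<Rightarrow> 'e) \<Rightarrow> ('f \<Rightarrow> 'e) \<Rightarrow> bool" where
  "kernel_le pair h k \<longleftrightarrow> kernel_positive pair (\<lambda>\<phi>. k \<phi> - h \<phi>)"


section \<open>Hilbert and Krein subspaces\<close>

text \<open>
  A Hilbert or Krein subspace of \<open>'e\<close> is given by its carrier \<open>S\<close> and its form \<open>B\<close>.  Values of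
  forms (and of fundamental symmetries) outside the carrier are irrelevant.
\<close>

definition hermitian_form ::
  "(complex \<Rightarrow> 'e::ab_group_add \<Rightarrow> 'e) \<Rightarrow> 'e set \<Rightarrow> ('e \<Rightarrow> 'e \<Rightarrow> complex) \<Rightarrow> bool" where
  "hermitian_form sE S B \<longleftrightarrow> module.subspace sE S \<and>
     (\<forall>x\<in>S. \<forall>y\<in>S. \<forall>z\<in>S. B (x + y) z = B x z + B y z) \<and>
     (\<forall>c. \<forall>x\<in>S. \<forall>y\<in>S. B (sE c x) y = c * B x y) \<and>
     (\<forall>x\<in>S. \<forall>y\<in>S. B y x = cnj (B x y))"

text \<open>The guard makes this symmetric everywhere, as the locale \<open>Metric_space\<close> requires.\<close>

definition form_dist :: "'e set \<Rightarrow> ('e::ab_group_add \<Rightarrow> 'e \<Rightarrow> complex) \<Rightarrow> 'e \<Rightarrow> 'e \<Rightarrow> real" where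
  "form_dist S B x y = (if x \<in> S \<and> y \<in> S then sqrt (Re (B (x - y) (x - y))) else 0)"

definition hilbert_space ::
  "(complex \<Rightarrow> 'e::ab_group_add \<Rightarrow> 'e) \<Rightarrow> 'e set \<Rightarrow> ('e \<Rightarrow> 'e \<Rightarrow> complex) \<Rightarrow> bool" where
  "hilbert_space sE S B \<longleftrightarrow> hermitian_form sE S B \<and>
     (\<forall>x\<in>S. x \<noteq> 0 \<longrightarrow> 0 < Re (B x x)) \<and>
     Metric_space.mcomplete S (form_dist S B)"

text \<open>
  The norm topology of a Hilbert space is its Mackey topology, so this is continuity of the
  inclusion for the Mackey topologies.
\<close>

definition continuously_included ::
  "(complex \<Rightarrow> 'f::ab_group_add \<Rightarrow> 'f) \<Rightarrow> ('f \<Rightarrow> 'e::ab_group_add \<Rightarrow> complex) \<Rightarrow>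
   'e set \<Rightarrow> ('e \<Rightarrow> 'e \<Rightarrow> complex) \<Rightarrow> bool" where
  "continuously_included sF pair S B \<longleftrightarrow>
     continuous_map (Metric_space.mtopology S (form_dist S B)) (mackey_E sF pair) (\<lambda>x. x)"

definition hilbert_subspace ::
  "(complex \<Rightarrow> 'e::ab_group_add \<Rightarrow> 'e) \<Rightarrow> (complex \<Rightarrow> 'f::ab_group_add \<Rightarrow> 'f) \<Rightarrow>
   ('f \<Rightarrow> 'e \<Rightarrow> complex) \<Rightarrow> 'e set \<Rightarrow> ('e \<Rightarrow> 'e \<Rightarrow> complex) \<Rightarrow> bool" where
  "hilbert_subspace sE sF pair S B \<longleftrightarrow> hilbert_space sE S B \<and> continuously_included sF pair S B"

definition fundamental_symmetry ::
  "(complex \<Rightarrow> 'e::ab_group_add \<Rightarrow> 'e) \<Rightarrow> 'e set \<Rightarrow> ('e \<Rightarrow> 'e \<Rightarrow> complex) \<Rightarrow>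
   ('e \<Rightarrow> 'e) \<Rightarrow> bool" where
  "fundamental_symmetry sE S B J \<longleftrightarrow> J ` S \<subseteq> S \<and>
     (\<forall>x\<in>S. \<forall>y\<in>S. J (x + y) = J x + J y) \<and> (\<forall>c. \<forall>x\<in>S. J (sE c x) = sE c (J x)) \<and>
     (\<forall>x\<in>S. J (J x) = x) \<and> hilbert_space sE S (\<lambda>x y. B (J x) y)"

text \<open>All fundamental symmetries yield equivalent norms, so one of them determines the topology.\<close>

definition krein_subspace ::
  "(complex \<Rightarrow> 'e::ab_group_add \<Rightarrow> 'e) \<Rightarrow> (complex \<Rightarrow> 'f::ab_group_add \<Rightarrow> 'f) \<Rightarrow>
   ('f \<Rightarrow> 'e \<Rightarrow> complex) \<Rightarrow> 'e set \<Rightarrow> ('e \<Rightarrow> 'e \<Rightarrow> complex) \<Rightarrow> bool" where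
  "krein_subspace sE sF pair S B \<longleftrightarrow> hermitian_form sE S B \<and>
     (\<exists>J. fundamental_symmetry sE S B J \<and> continuously_included sF pair S (\<lambda>x y. B (J x) y))"

text \<open>\<open>K\<close> is the kernel of the Hilbert or Krein subspace \<open>(S, B)\<close>.\<close>

definition kernel_of_subspace ::
  "(complex \<Rightarrow> 'e::ab_group_add \<Rightarrow> 'e) \<Rightarrow> (complex \<Rightarrow> 'f::ab_group_add \<Rightarrow> 'f) \<Rightarrow>
   ('f \<Rightarrow> 'e \<Rightarrow> complex) \<Rightarrow> 'e set \<Rightarrow> ('e \<Rightarrow> 'e \<Rightarrow> complex) \<Rightarrow> ('f \<Rightarrow> 'e) \<Rightarrow> bool" where
  "kernel_of_subspace sE sF pair S B K \<longleftrightarrow> kernel sE sF pair K \<and>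
     (\<forall>\<phi>. K \<phi> \<in> S) \<and> (\<forall>\<phi>. \<forall>k\<in>S. B (K \<phi>) k = pair \<phi> k)"

text \<open>
  \<open>(S, B)\<close> is the orthogonal direct sum of \<open>(S1, B1)\<close> and \<open>(S2, B2)\<close>; replacing \<open>B2\<close> by its
  negative gives the difference of \<open>(S1, B1)\<close> and \<open>(S2, B2)\<close>.
\<close>

definition direct_sum_form ::
  "'e::ab_group_add set \<Rightarrow> ('e \<Rightarrow> 'e \<Rightarrow> complex) \<Rightarrow> 'e set \<Rightarrow> ('e \<Rightarrow> 'e \<Rightarrow> complex) \<Rightarrow>
   'e set \<Rightarrow> ('e \<Rightarrow> 'e \<Rightarrow> complex) \<Rightarrow> bool" where
  "direct_sum_form S B S1 B1 S2 B2 \<longleftrightarrow>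
     S1 \<inter> S2 = {0} \<and> S = {x + y |x y. x \<in> S1 \<and> y \<in> S2} \<and>
     (\<forall>x\<in>S1. \<forall>x'\<in>S1. \<forall>y\<in>S2. \<forall>y'\<in>S2. B (x + y) (x' + y') = B1 x x' + B2 y y')"

definition minimal_krein_hilbert_pair ::
  "(complex \<Rightarrow> 'e::ab_group_add \<Rightarrow> 'e) \<Rightarrow> (complex \<Rightarrow> 'f::ab_group_add \<Rightarrow> 'f) \<Rightarrow>
   ('f \<Rightarrow> 'e \<Rightarrow> complex) \<Rightarrow> 'e set \<Rightarrow> ('e \<Rightarrow> 'e \<Rightarrow> complex) \<Rightarrow>
   'e set \<Rightarrow> ('e \<Rightarrow> 'e \<Rightarrow> complex) \<Rightarrow> bool" where
  "minimal_krein_hilbert_pair sE sF pair S B T A \<longleftrightarrow>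
     krein_subspace sE sF pair S B \<and> hilbert_subspace sE sF pair T A \<and>
     (\<exists>P BP N BN. hilbert_subspace sE sF pair P BP \<and> hilbert_subspace sE sF pair N BN \<and>
        direct_sum_form S B P BP N (\<lambda>x y. - BN x y) \<and> direct_sum_form T A P BP N BN)"

definition minimal_bound ::
  "(complex \<Rightarrow> 'e::ab_group_add \<Rightarrow> 'e) \<Rightarrow> (complex \<Rightarrow> 'f::ab_group_add \<Rightarrow> 'f) \<Rightarrow>
   ('f \<Rightarrow> 'e \<Rightarrow> complex) \<Rightarrow> 'e set \<Rightarrow> ('e \<Rightarrow> 'e \<Rightarrow> complex) \<Rightarrow> ('f \<Rightarrow> 'e) \<Rightarrow> bool" where
  "minimal_bound sE sF pair S B H \<longleftrightarrow>
     (\<exists>T A. minimal_krein_hilbert_pair sE sF pair S B T A \<and> kernel_of_subspace sE sF pair T A H)"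

text \<open>Invariance of the Krein subspace with carrier \<open>S\<close> and kernel \<open>K\<close>.\<close>

definition invariant_under ::
  "('f \<Rightarrow> 'e \<Rightarrow> complex) \<Rightarrow> ('e \<Rightarrow> 'e) set \<Rightarrow> 'e set \<Rightarrow> ('f \<Rightarrow> 'e) \<Rightarrow> bool" where
  "invariant_under pair G S K \<longleftrightarrow>
     (\<forall>g\<in>G. g ` S \<subseteq> S \<and> g \<circ> K \<circ> weak_adjoint pair g = K)"

end

theory Submission imports Defs begin

text \<open>
  The carrier of the Krein subspace is that of the Hilbert subspace with kernel \<open>H\<close> and form \<open>A\<close>,
  so the claim is that \<open>g\<close> preserves this carrier iff \<open>gHg* \<le> \<alpha>H\<close> for some \<open>\<alpha>\<close>, that is, iff
  \<open>H \<phi> \<mapsto> H (g* \<phi>)\<close> is bounded in the Hilbert norm.  If \<open>g\<close> preserves the carrier, then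
  \<open>A (H (g* \<phi>)) k = A (H \<phi>) (g k)\<close>, and the uniform boundedness principle applies to the vectors
  \<open>H (g* \<phi>)\<close> with \<open>H \<phi>\<close> in the unit ball.  Conversely, boundedness makes
  \<open>H \<phi> \<mapsto> pair \<phi> (g s) = A (H (g* \<phi>)) s\<close> a bounded functional for each \<open>s\<close> in the carrier; the
  vector representing it is \<open>g s\<close>.
\<close>

section \<open>Functionals continuous for the weak topology\<close>

text \<open>Induction over the generation of the open set: an intersection merges the two finite
  families and takes the smaller radius, a union keeps the data of the member containing
  \<open>x\<close>. Finiteness of \<open>\<Phi>\<close> is what later turns weak continuity into
  linear algebra.\<close>

lemma openin_initial_topologyE:
  assumes "openin (initial_topology fs) U" "x \<in> U"
  obtains \<Phi> \<epsilon> where "finite \<Phi>" "\<Phi> \<subseteq> fs" "0 < \<epsilon>"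
    "\<And>y. (\<And>f. f \<in> \<Phi> \<Longrightarrow> cmod (f y - f x) < \<epsilon>) \<Longrightarrow> y \<in> U"
proof -
  have "generate_topology_on {f -` U |f U. f \<in> fs \<and> open U} U"
    using assms(1) unfolding initial_topology_def by (rule openin_topology_generated_by)
  then have "x \<in> U \<longrightarrow> (\<exists>\<Phi> \<epsilon>. finite \<Phi> \<and> \<Phi> \<subseteq> fs \<and> 0 < \<epsilon> \<and>
      (\<forall>y. (\<forall>f\<in>\<Phi>. cmod (f y - f x) < \<epsilon>) \<longrightarrow> y \<in> U))"
  proof induction
    case Empty
    then show ?case by simp
  next
    case (Int a b)
    show ?case
    proof
      assume x: "x \<in> a \<inter> b"
      from Int x obtain \<Phi> \<epsilon> where a: "finite \<Phi>" "\<Phi> \<subseteq> fs" "0 < \<epsilon>"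
        "\<forall>y. (\<forall>f\<in>\<Phi>. cmod (f y - f x) < \<epsilon>) \<longrightarrow> y \<in> a" by auto
      from Int x obtain \<Psi> \<delta> where b: "finite \<Psi>" "\<Psi> \<subseteq> fs" "0 < \<delta>"
        "\<forall>y. (\<forall>f\<in>\<Psi>. cmod (f y - f x) < \<delta>) \<longrightarrow> y \<in> b" by auto
      show "\<exists>\<Phi> \<epsilon>. finite \<Phi> \<and> \<Phi> \<subseteq> fs \<and> 0 < \<epsilon> \<and>
          (\<forall>y. (\<forall>f\<in>\<Phi>. cmod (f y - f x) < \<epsilon>) \<longrightarrow> y \<in> a \<inter> b)"
        using a b by (intro exI[of _ "\<Phi> \<union> \<Psi>"] exI[of _ "min \<epsilon> \<delta>"]) auto
    qed
  next
    case (UN K)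
    then show ?case by (meson UnionE UnionI)
  next
    case (Basis s)
    show ?case
    proof
      assume x: "x \<in> s"
      from Basis obtain f V where f: "f \<in> fs" "open V" "s = f -` V" by auto
      from f x obtain \<epsilon> where "0 < \<epsilon>" "\<forall>z. dist z (f x) < \<epsilon> \<longrightarrow> z \<in> V"
        by (auto simp: open_dist)
      then show "\<exists>\<Phi> \<epsilon>. finite \<Phi> \<and> \<Phi> \<subseteq> fs \<and> 0 < \<epsilon> \<and>
          (\<forall>y. (\<forall>f\<in>\<Phi>. cmod (f y - f x) < \<epsilon>) \<longrightarrow> y \<in> s)"
        using f by (intro exI[of _ "{f}"] exI[of _ \<epsilon>]) (auto simp: dist_norm)
    qed
  qed
  with assms(2) that show thesis by metis
qed

context semi_duality
begin

section \<open>The pairing and the adjoints of weakly continuous maps\<close>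

lemma pair_zero_right [simp]: "pair \<phi> 0 = 0"
  using pair_add_right[of \<phi> 0 0] by simp

lemma pair_zero_left [simp]: "pair 0 x = 0"
  using pair_add_left[of 0 0 x] by simp

lemma pair_minus_right: "pair \<phi> (- x) = - pair \<phi> x"
  using pair_add_right[of \<phi> x "- x"] by (simp add: eq_neg_iff_add_eq_0 add.commute)

lemma pair_diff_right: "pair \<phi> (x - y) = pair \<phi> x - pair \<phi> y"
  using pair_add_right[of \<phi> x "- y"] by (simp add: pair_minus_right)

lemma pair_eq_left_iff: "(\<forall>x. pair \<phi> x = pair \<psi> x) \<longleftrightarrow> \<phi> = \<psi>"
proof
  assume *: "\<forall>x. pair \<phi> x = pair \<psi> x"
  have "pair (\<phi> - \<psi>) x = 0" for x
    using pair_add_left[of "\<phi> - \<psi>" \<psi> x] * by simp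
  then show "\<phi> = \<psi>"
    using nondegenerate_left[of "\<phi> - \<psi>"] by simp
qed simp

lemma pair_eq_right_iff: "(\<forall>\<phi>. pair \<phi> x = pair \<phi> y) \<longleftrightarrow> x = y"
  using nondegenerate_right[of "x - y"] by (auto simp: pair_diff_right)

lemma functional_eq_pair_of_finite:
  assumes "finite \<Phi>"
    and "\<And>x y. f (x + y) = f x + f y" "\<And>c x. f (sE c x) = cnj c * f x"
    and "\<And>x. (\<And>\<phi>. \<phi> \<in> \<Phi> \<Longrightarrow> pair \<phi> x = 0) \<Longrightarrow> f x = 0"
  shows "\<exists>\<psi>. \<forall>x. f x = pair \<psi> x"
  using assms
proof (induction \<Phi> arbitrary: f rule: finite_induct)
  case empty
  then show ?case by (intro exI[of _ 0]) simp
next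
  case (insert \<phi> \<Phi>)
  show ?case
  proof (cases "\<exists>x0. (\<forall>\<psi>\<in>\<Phi>. pair \<psi> x0 = 0) \<and> pair \<phi> x0 \<noteq> 0")
    case True
    then obtain x0 where x0: "\<And>\<psi>. \<psi> \<in> \<Phi> \<Longrightarrow> pair \<psi> x0 = 0" "pair \<phi> x0 \<noteq> 0" by blast
    define a where "a = f x0 / pair \<phi> x0"
    have "\<exists>\<psi>. \<forall>x. f x - a * pair \<phi> x = pair \<psi> x"
    proof (rule insert.IH)
      fix x assume x: "\<And>\<psi>. \<psi> \<in> \<Phi> \<Longrightarrow> pair \<psi> x = 0"
      \<comment> \<open>Moves \<open>x\<close> along \<open>x0\<close> into the zeros of
        \<open>pair \<phi>\<close>; the conjugate compensates the conjugate-linearity of the pairing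
        in its second argument.\<close>
      define c where "c = - cnj (pair \<phi> x / pair \<phi> x0)"
      have "f (x + sE c x0) = 0"
      proof (rule insert.prems(3))
        fix \<psi> assume "\<psi> \<in> insert \<phi> \<Phi>"
        then show "pair \<psi> (x + sE c x0) = 0"
          using x x0 by (auto simp: pair_add_right pair_scale_right c_def simp del: E.scale_minus_left)
      qed
      then show "f x - a * pair \<phi> x = 0"
        using x0(2) unfolding insert.prems(1,2) by (simp add: c_def a_def field_simps)
    qed (simp_all add: insert.prems pair_add_right pair_scale_right algebra_simps)
    then obtain \<psi> where "\<forall>x. f x - a * pair \<phi> x = pair \<psi> x" ..
    then have "\<forall>x. f x = pair (\<psi> + sF a \<phi>) x"
      by (simp add: pair_add_left pair_scale_left diff_eq_eq)
    then show ?thesis ..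
  next
    case False
    then show ?thesis
      using insert by blast
  qed
qed

lemma topspace_weak_E [simp]: "topspace (weak_E pair) = UNIV"
  unfolding weak_E_def initial_topology_def topology_generated_by_topspace
  by (auto intro!: exI[of _ UNIV])

text \<open>Turns the description operator in \<open>weak_adjoint\<close> into a usable identity.
  Weak continuity at 0 bounds \<open>x \<mapsto> pair \<phi> (g x)\<close> on a neighbourhood given
  by finitely many functionals, so it is itself a pairing; non-degeneracy gives uniqueness.\<close>

lemma weak_adjoint_pair:
  assumes "weak_endomorphism sE pair g"
  shows "pair (weak_adjoint pair g \<phi>) x = pair \<phi> (g x)"
proof -
  have lin: "Vector_Spaces.linear sE sE g" and
    cont: "continuous_map (weak_E pair) (weak_E pair) g"
    using assms by (auto simp: weak_endomorphism_def)
  have g: "g (x + y) = g x + g y" "g (sE c x) = sE c (g x)" for x y c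
    using lin by (auto simp: Vector_Spaces.linear_iff)
  have g0: "g 0 = 0"
    using g(1)[of 0 0] by simp
  have "openin (weak_E pair) (pair \<phi> -` ball 0 1)"
    unfolding weak_E_def initial_topology_def by (rule topology_generated_by_Basis) auto
  from openin_continuous_map_preimage[OF cont this]
  have "openin (weak_E pair) {x. g x \<in> pair \<phi> -` ball 0 1}"
    by (simp only: topspace_weak_E UNIV_I simp_thms)
  then obtain \<Phi> \<epsilon> where \<Phi>: "finite \<Phi>" "\<Phi> \<subseteq> range pair" "0 < \<epsilon>"
    "\<And>y. (\<And>f. f \<in> \<Phi> \<Longrightarrow> cmod (f y - f 0) < \<epsilon>) \<Longrightarrow> y \<in> {x. g x \<in> pair \<phi> -` ball 0 1}"
    unfolding weak_E_def by (rule openin_initial_topologyE[where x = 0]) (simp_all add: g0)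
  obtain \<Psi> where \<Psi>: "finite \<Psi>" "\<Phi> = pair ` \<Psi>"
    using finite_subset_image[OF \<Phi>(1,2)] by blast
  have "\<exists>\<psi>. \<forall>x. pair \<phi> (g x) = pair \<psi> x"
  proof (rule functional_eq_pair_of_finite[OF \<Psi>(1)])
    fix x assume x: "\<And>\<psi>. \<psi> \<in> \<Psi> \<Longrightarrow> pair \<psi> x = 0"
    show "pair \<phi> (g x) = 0"
    proof (rule ccontr)
      assume nz: "pair \<phi> (g x) \<noteq> 0"
      \<comment> \<open>All of \<open>\<Psi>\<close> vanishes at \<open>y\<close> too, so
        \<open>y\<close> lies in the neighbourhood of 0; yet the rescaling gives
        \<open>pair \<phi> (g y)\<close> the value 1, outside the open unit ball.\<close>
      define y where "y = sE (cnj (1 / pair \<phi> (g x))) x"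
      have "y \<in> {x. g x \<in> pair \<phi> -` ball 0 1}"
        by (rule \<Phi>(4)) (use \<Phi>(3) x in \<open>auto simp: \<Psi>(2) y_def pair_scale_right\<close>)
      moreover have "pair \<phi> (g y) = 1"
        using nz by (simp add: y_def g pair_scale_right)
      ultimately show False by simp
    qed
  qed (simp_all add: g pair_add_right pair_scale_right)
  then obtain \<psi> where "\<forall>x. pair \<phi> (g x) = pair \<psi> x" ..
  then have \<psi>: "\<forall>x. pair \<psi> x = pair \<phi> (g x)" by simp
  then have "weak_adjoint pair g \<phi> = \<psi>"
    unfolding weak_adjoint_def
  proof (rule the_equality)
    fix \<psi>' assume "\<forall>x. pair \<psi>' x = pair \<phi> (g x)"
    with \<psi> show "\<psi>' = \<psi>" by (simp flip: pair_eq_left_iff)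
  qed
  with \<psi> show ?thesis by simp
qed

end


section \<open>Hilbert spaces on a carrier\<close>

text \<open>The norm comes from \<open>A\<close> and lives on a subset of the ambient type, hence
  metric and completeness are set-based instead of type-class based.\<close>

locale carrier_hilbert_space = vector_space scale
  for scale :: "complex \<Rightarrow> 'e::ab_group_add \<Rightarrow> 'e" +
  fixes S :: "'e set" and A :: "'e \<Rightarrow> 'e \<Rightarrow> complex"
  assumes hilbert: "hilbert_space scale S A"
begin

section \<open>Norm, Cauchy-Schwarz and triangle inequality\<close>

definition nrm :: "'e \<Rightarrow> real" where
  "nrm x = sqrt (Re (A x x))"

lemma
  shows subspace_S: "subspace S"
    and form_add_left: "\<lbrakk>x \<in> S; y \<in> S; z \<in> S\<rbrakk> \<Longrightarrow> A (x + y) z = A x z + A y z"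
    and form_scale_left: "\<lbrakk>x \<in> S; y \<in> S\<rbrakk> \<Longrightarrow> A (scale c x) y = c * A x y"
    and form_commute: "\<lbrakk>x \<in> S; y \<in> S\<rbrakk> \<Longrightarrow> A y x = cnj (A x y)"
    and form_pos: "\<lbrakk>x \<in> S; x \<noteq> 0\<rbrakk> \<Longrightarrow> 0 < Re (A x x)"
    and mcomplete_S: "Metric_space.mcomplete S (form_dist S A)"
  using hilbert unfolding hilbert_space_def hermitian_form_def by blast+

lemmas S_closed = subspace_0[OF subspace_S] subspace_add[OF subspace_S]
  subspace_diff[OF subspace_S] subspace_scale[OF subspace_S]

lemma form_add_right: "\<lbrakk>x \<in> S; y \<in> S; z \<in> S\<rbrakk> \<Longrightarrow> A z (x + y) = A z x + A z y"
  by (metis S_closed(2) complex_cnj_add form_add_left form_commute)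

lemma form_scale_right: "\<lbrakk>x \<in> S; y \<in> S\<rbrakk> \<Longrightarrow> A x (scale c y) = cnj c * A x y"
  by (metis S_closed(4) complex_cnj_mult form_commute form_scale_left)

lemma form_diff_left: "\<lbrakk>x \<in> S; y \<in> S; z \<in> S\<rbrakk> \<Longrightarrow> A (x - y) z = A x z - A y z"
  by (metis S_closed(3) add_diff_cancel_right' diff_add_cancel form_add_left)

lemma form_diff_right: "\<lbrakk>x \<in> S; y \<in> S; z \<in> S\<rbrakk> \<Longrightarrow> A z (x - y) = A z x - A z y"
  by (metis S_closed(3) add_diff_cancel_right' diff_add_cancel form_add_right)

lemma form_zero [simp]: "A 0 0 = 0"
  using form_add_left[of 0 0 0] by (simp add: S_closed)

lemma form_nonneg: "x \<in> S \<Longrightarrow> 0 \<le> Re (A x x)"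
  using form_pos[of x] by (cases "x = 0") auto

lemma nrm_nonneg: "x \<in> S \<Longrightarrow> 0 \<le> nrm x"
  by (simp add: nrm_def form_nonneg)

lemma nrm_sq: "x \<in> S \<Longrightarrow> (nrm x)\<^sup>2 = Re (A x x)"
  by (simp add: nrm_def form_nonneg)

lemma form_self: "x \<in> S \<Longrightarrow> A x x = of_real ((nrm x)\<^sup>2)"
  using form_commute[of x x] by (simp add: nrm_sq complex_eq_iff)

lemma nrm_eq_0_iff: "x \<in> S \<Longrightarrow> nrm x = 0 \<longleftrightarrow> x = 0"
  using form_pos[of x] by (cases "x = 0") (auto simp: nrm_def)

lemma nrm_scale: "x \<in> S \<Longrightarrow> nrm (scale c x) = cmod c * nrm x"
proof -
  assume x: "x \<in> S"
  have "A (scale c x) (scale c x) = c * cnj c * of_real ((nrm x)\<^sup>2)"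
    using x unfolding form_self[OF x, symmetric]
    by (simp add: form_scale_left form_scale_right S_closed mult_ac)
  also have "\<dots> = of_real ((cmod c * nrm x)\<^sup>2)"
    by (simp only: complex_norm_square[symmetric] power_mult_distrib of_real_mult of_real_power)
  finally have "(nrm (scale c x))\<^sup>2 = (cmod c * nrm x)\<^sup>2"
    using x by (simp only: nrm_sq S_closed Re_complex_of_real)
  then show ?thesis
    using x by (simp add: nrm_nonneg S_closed)
qed

lemma nrm_add_sq:
  assumes "x \<in> S" "y \<in> S"
  shows "(nrm (x + y))\<^sup>2 = (nrm x)\<^sup>2 + 2 * Re (A x y) + (nrm y)\<^sup>2"
  using assms form_commute[of x y] by (simp add: nrm_sq S_closed form_add_left form_add_right)

lemma nrm_diff_sq:
  assumes "x \<in> S" "y \<in> S"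
  shows "(nrm (x - y))\<^sup>2 = (nrm x)\<^sup>2 - 2 * Re (A x y) + (nrm y)\<^sup>2"
  using assms form_commute[of x y] by (simp add: nrm_sq S_closed form_diff_left form_diff_right)

lemma Cauchy_Schwarz:
  assumes x: "x \<in> S" and y: "y \<in> S"
  shows "cmod (A x y) \<le> nrm x * nrm y"
proof (cases "y = 0")
  case True
  have "A x 0 = 0"
    using form_scale_right[of x x 0] x by simp
  then show ?thesis
    using True x y by (simp add: nrm_nonneg)
next
  case False
  define a where "a = A x y"
  define n where "n = (nrm y)\<^sup>2"
  have n: "0 < n"
    using False y nrm_eq_0_iff by (simp add: n_def)
  have "0 \<le> (nrm (x - scale (a / n) y))\<^sup>2" by simp
  also have "\<dots> = (nrm x)\<^sup>2 - 2 * Re (cnj (a / n) * a) + (cmod (a / n))\<^sup>2 * n"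
    using x y by (simp add: nrm_diff_sq S_closed form_scale_right nrm_scale a_def n_def
        power_mult_distrib)
  also have "\<dots> = (nrm x)\<^sup>2 - (cmod a)\<^sup>2 / n"
  proof -
    have "Re (cnj (a / n) * a) = (cmod a)\<^sup>2 / n"
      using n unfolding cmod_power2 by (simp add: add_divide_distrib power2_eq_square)
    moreover have "(cmod (a / n))\<^sup>2 * n = (cmod a)\<^sup>2 / n"
      using n by (simp add: norm_divide power_divide field_simps power2_eq_square)
    ultimately show ?thesis by linarith
  qed
  finally have "(cmod a)\<^sup>2 \<le> (nrm x * nrm y)\<^sup>2"
    using n by (simp add: field_simps n_def)
  then show ?thesis
    unfolding a_def using nrm_nonneg x y by (meson mult_nonneg_nonneg power2_le_imp_le)
qed

lemma nrm_triangle: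
  assumes x: "x \<in> S" and y: "y \<in> S"
  shows "nrm (x + y) \<le> nrm x + nrm y"
proof (rule power2_le_imp_le)
  have "Re (A x y) \<le> nrm x * nrm y"
    using Cauchy_Schwarz[OF x y] complex_Re_le_cmod order_trans by blast
  then show "(nrm (x + y))\<^sup>2 \<le> (nrm x + nrm y)\<^sup>2"
    by (simp add: nrm_add_sq[OF x y] power2_sum)
qed (simp add: assms nrm_nonneg)

section \<open>The norm metric and the uniform boundedness principle\<close>

lemma form_dist_eq: "\<lbrakk>x \<in> S; y \<in> S\<rbrakk> \<Longrightarrow> form_dist S A x y = nrm (x - y)"
  by (simp add: form_dist_def nrm_def)

sublocale M: Metric_space S "form_dist S A"
proof
  show "0 \<le> form_dist S A x y" for x y
    by (simp add: form_dist_def form_nonneg S_closed)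
  show "form_dist S A x y = form_dist S A y x" for x y
  proof (cases "x \<in> S \<and> y \<in> S")
    case True
    then have "nrm (x - y) = nrm (y - x)"
      using nrm_scale[of "y - x" "-1"] by (simp add: S_closed)
    with True show ?thesis by (simp add: form_dist_eq)
  qed (auto simp: form_dist_def)
  show "form_dist S A x y = 0 \<longleftrightarrow> x = y" if "x \<in> S" "y \<in> S" for x y
    using that by (simp add: form_dist_eq nrm_eq_0_iff S_closed)
  show "form_dist S A x z \<le> form_dist S A x y + form_dist S A y z"
    if "x \<in> S" "y \<in> S" "z \<in> S" for x y z
    using that nrm_triangle[of "x - y" "y - z"] by (simp add: form_dist_eq S_closed)
qed

text \<open>Supplies the closed sets for the Baire argument below. By Cauchy-Schwarz,
  \<open>A u\<close> changes by less than the excess \<open>cmod (A u k) - c\<close> on a small ball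
  around a point \<open>k\<close> outside the set.\<close>

lemma closedin_form_bounded:
  assumes u: "u \<in> S"
  shows "closedin M.mtopology {k \<in> S. cmod (A u k) \<le> c}"
  unfolding closedin_def M.topspace_mtopology
proof (intro conjI)
  have "\<exists>r>0. M.mball k r \<subseteq> S - {k \<in> S. cmod (A u k) \<le> c}"
    if k: "k \<in> S" "\<not> cmod (A u k) \<le> c" for k
  proof (intro exI conjI subsetI)
    \<comment> \<open>The summand 1 keeps the denominator positive when \<open>u\<close> is
      0.\<close>
    define r where "r = (cmod (A u k) - c) / (nrm u + 1)"
    show "0 < r"
      using k nrm_nonneg[OF u] by (simp add: r_def)
    fix z assume "z \<in> M.mball k r"
    then have z: "z \<in> S" "nrm (k - z) < r"
      using k by (auto simp: form_dist_eq)
    have "cmod (A u k) \<le> cmod (A u z) + cmod (A u (k - z))"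
      using u k z norm_triangle_ineq[of "A u z" "A u (k - z)"] by (simp add: form_diff_right)
    also have "cmod (A u (k - z)) \<le> nrm u * nrm (k - z)"
      using u k z by (intro Cauchy_Schwarz S_closed)
    also have "\<dots> \<le> nrm u * r"
      using z nrm_nonneg[OF u] by (intro mult_left_mono) auto
    also have "\<dots> < (nrm u + 1) * r"
      using \<open>0 < r\<close> by simp
    also have "\<dots> = cmod (A u k) - c"
      using nrm_nonneg[OF u] by (simp add: r_def)
    finally show "z \<in> S - {k \<in> S. cmod (A u k) \<le> c}"
      using z by auto
  qed
  then show "openin M.mtopology (S - {k \<in> S. cmod (A u k) \<le> c})"
    unfolding M.openin_mtopology by auto
qed auto

text \<open>Baire category: the closed sets \<open>C n\<close>, on each of which one bound serves
  all of \<open>U\<close>, cover the complete space \<open>S\<close>, so some \<open>C n\<close>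
  contains a ball. Moving from its centre in the direction of \<open>u\<close> bounds the norm of
  \<open>u\<close>.\<close>

lemma uniform_boundedness:
  assumes U: "U \<subseteq> S" and bdd: "\<And>k. k \<in> S \<Longrightarrow> \<exists>c. \<forall>u\<in>U. cmod (A u k) \<le> c"
  shows "\<exists>c. \<forall>u\<in>U. nrm u \<le> c"
proof (cases "U = {}")
  case False
  \<comment> \<open>An intersection over an empty \<open>U\<close> would be the whole type, which is
    why that case is split off.\<close>
  define C where "C n = (\<Inter>u\<in>U. {k \<in> S. cmod (A u k) \<le> real n})" for n :: nat
  have C_closed: "closedin M.mtopology (C n)" for n
    unfolding C_def using U False by (intro closedin_INT closedin_form_bounded) auto
  have "\<Union> (range C) = S"
  proof
    show "S \<subseteq> \<Union> (range C)"
    proof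
      fix k assume k: "k \<in> S"
      then obtain c where c: "\<forall>u\<in>U. cmod (A u k) \<le> c"
        using bdd by blast
      moreover obtain n where "c \<le> real n"
        using real_arch_simple by blast
      ultimately have "k \<in> C n"
        using k by (auto simp: C_def intro: order_trans)
      then show "k \<in> \<Union> (range C)" by blast
    qed
  qed (use False in \<open>auto simp: C_def\<close>)
  then have "M.mtopology interior_of \<Union> (range C) \<noteq> {}"
    using S_closed(1) interior_of_topspace[of M.mtopology] by auto
  then obtain n where "M.mtopology interior_of C n \<noteq> {}"
    using M.metric_Baire_category_alt[OF mcomplete_S, of "range C"] C_closed by auto
  then obtain x0 W where W: "x0 \<in> W" "openin M.mtopology W" "W \<subseteq> C n"
    by (auto simp: interior_of_def)
  then obtain r where r: "0 < r" and "M.mball x0 r \<subseteq> W" and x0: "x0 \<in> S"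
    by (metis M.openin_mtopology subsetD)
  with W have ball: "M.mball x0 r \<subseteq> C n" by (meson order_trans)
  have "nrm u \<le> 4 * real n / r" if u: "u \<in> U" for u
  proof (cases "nrm u = 0")
    case True
    then show ?thesis using r by simp
  next
    case nz: False
    have uS: "u \<in> S" using u U by auto
    with nz have pos: "0 < nrm u" using nrm_nonneg[of u] by auto
    \<comment> \<open>This step length puts \<open>z\<close> at distance \<open>r / 2\<close> from
      \<open>x0\<close>, inside the ball; the values of \<open>A u\<close> at \<open>z\<close> and
      \<open>x0\<close> then differ by \<open>r * nrm u / 2\<close>, which is at most
      \<open>2 * n\<close>.\<close>
    define a where "a = r / (2 * nrm u)"
    have a: "0 < a" using r pos by (simp add: a_def)
    define z where "z = x0 + scale (of_real a) u"
    have z: "z \<in> S" using x0 uS by (simp add: z_def S_closed)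
    have "form_dist S A x0 z = r / 2"
      using x0 z uS a pos unfolding M.commute[of x0]
      by (simp add: form_dist_eq z_def nrm_scale) (simp add: a_def)
    then have "z \<in> C n" "x0 \<in> C n"
      using ball x0 z r by (auto simp: subset_iff)
    then have "cmod (A u z) \<le> n" "cmod (A u x0) \<le> n"
      using u by (auto simp: C_def)
    then have "cmod (A u z - A u x0) \<le> 2 * n"
      using norm_triangle_ineq4[of "A u z" "A u x0"] by simp
    moreover have "A u z - A u x0 = of_real (a * (nrm u)\<^sup>2)"
      using x0 uS by (simp add: z_def form_add_right form_scale_right S_closed form_self)
    ultimately have "a * (nrm u)\<^sup>2 \<le> 2 * n"
      using a by (simp only: norm_of_real)
    then show ?thesis
      using r pos by (simp add: a_def field_simps power2_eq_square)
  qed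
  then show ?thesis by blast
qed simp

text \<open>
  Riesz representation on the range of \<open>h\<close>.  The representing vector is the limit of \<open>h \<phi>\<close> along
  a sequence minimising \<open>\<phi> \<mapsto> (nrm (h \<phi>))\<^sup>2 - 2 * Re (l \<phi>)\<close>, so neither an extension of \<open>l\<close> to
  \<open>S\<close> nor an orthogonal projection is needed.
\<close>

lemma riesz_on_range:
  assumes h: "Vector_Spaces.linear sF scale h" and hS: "\<And>\<phi>. h \<phi> \<in> S"
    and l: "Vector_Spaces.linear sF (*) l"
    and bdd: "\<And>\<phi>. cmod (l \<phi>) \<le> C * nrm (h \<phi>)"
  obtains t where "t \<in> S" "\<And>\<phi>. A (h \<phi>) t = l \<phi>"
proof -
  have ha: "h (\<phi> + \<psi>) = h \<phi> + h \<psi>" and hs: "h (sF c \<phi>) = scale c (h \<phi>)" for \<phi> \<psi> c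
    using h by (auto simp: Vector_Spaces.linear_iff)
  have la: "l (\<phi> + \<psi>) = l \<phi> + l \<psi>" and ls: "l (sF c \<phi>) = c * l \<phi>" for \<phi> \<psi> c
    using l by (auto simp: Vector_Spaces.linear_iff)
  \<comment> \<open>If \<open>t\<close> represents \<open>l\<close>, then \<open>q \<phi>\<close> is
    the squared distance from \<open>h \<phi>\<close> to \<open>t\<close> minus
    \<open>(nrm t)\<^sup>2\<close>; minimising \<open>q\<close> brings \<open>h \<phi>\<close> as
    close to \<open>t\<close> as the range of \<open>h\<close> allows.\<close>
  define q where "q \<phi> = (nrm (h \<phi>))\<^sup>2 - 2 * Re (l \<phi>)" for \<phi>
  define m where "m = (INF \<phi>. q \<phi>)"
  \<comment> \<open>Completing the square in \<open>nrm (h \<phi>)\<close>; this is where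
    boundedness of \<open>l\<close> enters.\<close>
  have "- C\<^sup>2 \<le> q \<phi>" for \<phi>
  proof -
    have "Re (l \<phi>) \<le> C * nrm (h \<phi>)"
      using bdd complex_Re_le_cmod order_trans by blast
    moreover have "0 \<le> (nrm (h \<phi>) - C)\<^sup>2" by simp
    ultimately show ?thesis
      unfolding q_def power2_diff by (simp add: mult.commute)
  qed
  then have bdd_q: "bdd_below (range q)" by (intro bdd_belowI) auto
  then have m_le: "m \<le> q \<phi>" for \<phi>
    unfolding m_def by (rule cINF_lower) simp
  have "\<exists>\<phi>. q \<phi> < m + 1 / real (Suc n)" for n
  proof (rule ccontr)
    assume "\<not> ?thesis"
    then have "m + 1 / real (Suc n) \<le> (INF \<phi>. q \<phi>)"
      by (intro cINF_greatest) (auto simp: not_less)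
    then show False by (simp add: m_def)
  qed
  then obtain p where p: "\<And>n. q (p n) < m + 1 / real (Suc n)" by metis
  define x where "x n = h (p n)" for n
  have xS: "x n \<in> S" for n by (simp add: x_def hS)
  \<comment> \<open>Parallelogram law: the midpoint \<open>y\<close> of two almost minimal arguments
    still satisfies \<open>m \<le> q y\<close>, which forces \<open>x i\<close> and
    \<open>x j\<close> to be close.\<close>
  have x_close: "(nrm (x i - x j))\<^sup>2 \<le> 4 / real (Suc n)" if "n \<le> i" "n \<le> j" for i j n
  proof -
    define y where "y = sF (1/2) (p i + p j)"
    have "h y = scale (1/2) (x i + x j)"
      by (simp add: y_def ha hs x_def)
    then have "(nrm (h y))\<^sup>2 = (nrm (x i + x j))\<^sup>2 / 4"
      using xS by (simp add: nrm_scale S_closed power_divide)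
    moreover have "Re (l y) = (Re (l (p i)) + Re (l (p j))) / 2"
      by (simp add: y_def la ls)
    ultimately have "(nrm (x i - x j))\<^sup>2 = 2 * q (p i) + 2 * q (p j) - 4 * q y"
      using xS by (simp add: q_def nrm_add_sq nrm_diff_sq flip: x_def)
    moreover have "1 / real (Suc i) \<le> 1 / real (Suc n)" "1 / real (Suc j) \<le> 1 / real (Suc n)"
      using that by (auto intro!: divide_left_mono)
    ultimately show ?thesis
      using p[of i] p[of j] m_le[of y] by simp
  qed
  have "M.MCauchy x"
    unfolding M.MCauchy_def
  proof (intro conjI allI impI)
    fix e :: real assume e: "0 < e"
    obtain n where n: "4 / e\<^sup>2 < real (Suc n)"
      using reals_Archimedean2 less_trans of_nat_less_iff lessI by metis
    have n_lt: "4 / real (Suc n) < e\<^sup>2"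
      using n e by (simp add: field_simps)
    have "form_dist S A (x i) (x j) < e" if "n \<le> i" "n \<le> j" for i j
    proof -
      have "(nrm (x i - x j))\<^sup>2 < e\<^sup>2"
        using x_close[OF that] n_lt by simp
      then show ?thesis
        using e xS by (simp add: form_dist_eq power_less_imp_less_base)
    qed
    then show "\<exists>N. \<forall>i j. N \<le> i \<longrightarrow> N \<le> j \<longrightarrow> form_dist S A (x i) (x j) < e" by blast
  qed (use xS in auto)
  then obtain t where "limitin M.mtopology x t sequentially"
    using mcomplete_S unfolding M.mcomplete_def by blast
  then have t: "t \<in> S" and lim: "(\<lambda>n. nrm (x n - t)) \<longlonglongrightarrow> 0"
    unfolding M.limit_metric_sequentially LIMSEQ_def
    using xS by (auto simp: form_dist_eq nrm_nonneg S_closed)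
  have "A (h \<psi>) t = l \<psi>" for \<psi>
  proof -
    define k where "k = (nrm (h \<psi>))\<^sup>2"
    have k: "0 \<le> k" by (simp add: k_def)
    define w where "w = A (h \<psi>) t - l \<psi>"
    have "(\<lambda>n. A (h \<psi>) (x n) - A (h \<psi>) t) \<longlonglongrightarrow> 0"
    proof (rule Lim_null_comparison)
      show "\<forall>\<^sub>F n in sequentially. cmod (A (h \<psi>) (x n) - A (h \<psi>) t) \<le> nrm (h \<psi>) * nrm (x n - t)"
        using Cauchy_Schwarz[OF hS, of "x _ - t"] xS t hS
        by (auto simp: form_diff_right S_closed intro!: always_eventually)
      show "(\<lambda>n. nrm (h \<psi>) * nrm (x n - t)) \<longlonglongrightarrow> 0"
        using tendsto_mult_right_zero[OF lim] .
    qed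
    then have wlim: "(\<lambda>n. A (h \<psi>) (x n) - l \<psi>) \<longlonglongrightarrow> w"
      unfolding w_def by (intro tendsto_diff tendsto_const) (simp add: LIM_zero_iff)
    \<comment> \<open>Perturbing \<open>p n\<close> by \<open>sF c \<psi>\<close> cannot bring
      \<open>q\<close> below \<open>m\<close>, while \<open>q (p n)\<close> exceeds \<open>m\<close>
      by less than \<open>1 / Suc n\<close>; the limit is the variational inequality at the
      minimum.\<close>
    have nonneg: "0 \<le> 2 * Re (c * w) + (cmod c)\<^sup>2 * k" for c
    proof (rule LIMSEQ_le)
      show "(\<lambda>n. - (1 / real (Suc n))) \<longlonglongrightarrow> 0"
        using tendsto_minus[OF LIMSEQ_Suc[OF lim_1_over_n[where 'a = real]]] by simp
      show "(\<lambda>n. 2 * Re (c * (A (h \<psi>) (x n) - l \<psi>)) + (cmod c)\<^sup>2 * k)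
          \<longlonglongrightarrow> 2 * Re (c * w) + (cmod c)\<^sup>2 * k"
        by (intro tendsto_intros wlim)
      have "- (1 / real (Suc n)) \<le> 2 * Re (c * (A (h \<psi>) (x n) - l \<psi>)) + (cmod c)\<^sup>2 * k" for n
      proof -
        have "q (p n + sF c \<psi>) = q (p n) + 2 * Re (c * (A (h \<psi>) (x n) - l \<psi>)) + (cmod c)\<^sup>2 * k"
        proof -
          have "(nrm (h (p n + sF c \<psi>)))\<^sup>2 = (nrm (scale c (h \<psi>) + x n))\<^sup>2"
            by (simp add: ha hs x_def add.commute)
          also have "\<dots> = (cmod c)\<^sup>2 * k + 2 * Re (c * A (h \<psi>) (x n)) + (nrm (x n))\<^sup>2"
            using xS hS by (simp add: nrm_add_sq S_closed nrm_scale form_scale_left k_def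
                power_mult_distrib)
          finally show ?thesis
            by (simp add: q_def la ls x_def algebra_simps)
        qed
        then show ?thesis
          using m_le[of "p n + sF c \<psi>"] p[of n] by simp
      qed
      then show "\<exists>N. \<forall>n\<ge>N. - (1 / real (Suc n)) \<le>
          2 * Re (c * (A (h \<psi>) (x n) - l \<psi>)) + (cmod c)\<^sup>2 * k" by blast
    qed
    \<comment> \<open>The inequality is tested at \<open>c = - (r * cnj w)\<close>. Adding 1 to
      \<open>k\<close> allows \<open>k = 0\<close>, and \<open>r * k \<le> 1\<close> makes the
      resulting expression negative unless \<open>w = 0\<close>.\<close>
    define r where "r = 1 / (k + 1)"
    have r: "0 < r" "r * k \<le> 1"
      using k by (auto simp: r_def)
    have "0 \<le> 2 * Re (- (of_real r * cnj w) * w) + (cmod (- (of_real r * cnj w)))\<^sup>2 * k"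
      by (rule nonneg)
    also have "\<dots> = r * (cmod w)\<^sup>2 * (r * k - 2)"
    proof -
      have "cnj w * w = of_real ((cmod w)\<^sup>2)"
        by (metis complex_norm_square mult.commute)
      then have "- (of_real r * cnj w) * w = of_real (- (r * (cmod w)\<^sup>2))"
        by (simp add: mult.assoc)
      then have "Re (- (of_real r * cnj w) * w) = - (r * (cmod w)\<^sup>2)"
        by (simp only: Re_complex_of_real)
      moreover have "(cmod (- (of_real r * cnj w)))\<^sup>2 = r\<^sup>2 * (cmod w)\<^sup>2"
        by (simp add: norm_mult power_mult_distrib)
      ultimately show ?thesis
        by (simp only:) (simp add: algebra_simps power2_eq_square)
    qed
    finally have *: "0 \<le> r * (cmod w)\<^sup>2 * (r * k - 2)" .
    have "w = 0"
    proof (rule ccontr)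
      assume "w \<noteq> 0"
      then have "r * (cmod w)\<^sup>2 * (r * k - 2) < 0"
        using r by (intro mult_pos_neg) auto
      with * show False by simp
    qed
    then show ?thesis by (simp add: w_def)
  qed
  with t show thesis by (rule that)
qed

end


section \<open>Invariance and domination of kernels\<close>

locale hilbert_subspace_kernel =
  semi_duality sE sF pair + carrier_hilbert_space sE S A
  for sE :: "complex \<Rightarrow> 'e::ab_group_add \<Rightarrow> 'e"
    and sF :: "complex \<Rightarrow> 'f::ab_group_add \<Rightarrow> 'f"
    and pair :: "'f \<Rightarrow> 'e \<Rightarrow> complex"
    and S :: "'e set" and A :: "'e \<Rightarrow> 'e \<Rightarrow> complex" +
  fixes H :: "'f \<Rightarrow> 'e"
  assumes kernel_H: "kernel_of_subspace sE sF pair S A H"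
begin

lemma
  shows H_linear: "Vector_Spaces.linear sF sE H"
    and H_carrier: "H \<phi> \<in> S"
    and H_reproducing: "k \<in> S \<Longrightarrow> A (H \<phi>) k = pair \<phi> k"
  using kernel_H unfolding kernel_of_subspace_def kernel_def by blast+

lemma pair_H: "pair \<phi> (H \<phi>) = of_real ((nrm (H \<phi>))\<^sup>2)"
  by (metis H_carrier H_reproducing form_self)

text \<open>Moving \<open>g\<close> across the pairing turns the quadratic form of the conjugated
  kernel into a squared norm, so the order of kernels becomes a norm estimate.\<close>

lemma kernel_le_iff:
  assumes "weak_endomorphism sE pair g"
  shows "kernel_le pair (g \<circ> H \<circ> weak_adjoint pair g) (\<lambda>\<phi>. sE (complex_of_real \<alpha>) (H \<phi>)) \<longleftrightarrow>
    (\<forall>\<phi>. (nrm (H (weak_adjoint pair g \<phi>)))\<^sup>2 \<le> \<alpha> * (nrm (H \<phi>))\<^sup>2)"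
proof -
  have "pair \<phi> (sE (complex_of_real \<alpha>) (H \<phi>) - (g \<circ> H \<circ> weak_adjoint pair g) \<phi>) =
      complex_of_real (\<alpha> * (nrm (H \<phi>))\<^sup>2 - (nrm (H (weak_adjoint pair g \<phi>)))\<^sup>2)" for \<phi>
    by (simp add: pair_diff_right pair_scale_right pair_H flip: weak_adjoint_pair[OF assms])
  then show ?thesis
    by (simp only: kernel_le_def kernel_positive_def nonneg_Reals_of_real_iff) simp
qed

text \<open>Continuity of \<open>g\<close> in the norm of \<open>S\<close> is not presupposed:
  invariance puts \<open>g k\<close> in \<open>S\<close>, which bounds each functional by
  \<open>nrm (g k)\<close>, and uniform boundedness does the rest. Homogeneity spreads the bound
  from the unit ball to all \<open>\<phi>\<close>.\<close>

lemma image_subset_imp_kernel_le: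
  assumes g: "weak_endomorphism sE pair g" and inv: "g ` S \<subseteq> S"
  shows "\<exists>\<alpha>. kernel_le pair (g \<circ> H \<circ> weak_adjoint pair g) (\<lambda>\<phi>. sE (complex_of_real \<alpha>) (H \<phi>))"
proof -
  let ?a = "weak_adjoint pair g"
  have adj: "A (H (?a \<phi>)) k = A (H \<phi>) (g k)" if "k \<in> S" for \<phi> k
    using that inv by (simp add: H_reproducing weak_adjoint_pair[OF g] image_subset_iff)
  have "\<exists>c. \<forall>u\<in>{H (?a \<phi>) |\<phi>. nrm (H \<phi>) \<le> 1}. nrm u \<le> c"
  proof (rule uniform_boundedness)
    fix k assume k: "k \<in> S"
    then have gk: "g k \<in> S" using inv by auto
    have "cmod (A (H (?a \<phi>)) k) \<le> nrm (g k)" if "nrm (H \<phi>) \<le> 1" for \<phi>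
      using Cauchy_Schwarz[OF H_carrier gk, of \<phi>] that nrm_nonneg[OF gk]
        mult_right_mono[of "nrm (H \<phi>)" 1 "nrm (g k)"] by (simp add: adj[OF k])
    then show "\<exists>c. \<forall>u\<in>{H (?a \<phi>) |\<phi>. nrm (H \<phi>) \<le> 1}. cmod (A u k) \<le> c" by blast
  qed (auto simp: H_carrier)
  then obtain c where c: "\<And>\<phi>. nrm (H \<phi>) \<le> 1 \<Longrightarrow> nrm (H (?a \<phi>)) \<le> c" by blast
  have Hs: "H (sF z \<phi>) = sE z (H \<phi>)" for z \<phi>
    using H_linear by (auto simp: Vector_Spaces.linear_iff)
  have as: "?a (sF z \<phi>) = sF z (?a \<phi>)" for z \<phi>
    unfolding pair_eq_left_iff[symmetric] by (simp add: weak_adjoint_pair[OF g] pair_scale_left)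
  have "nrm (H (?a \<phi>)) \<le> c * nrm (H \<phi>)" for \<phi>
  proof (cases "nrm (H \<phi>) = 0")
    case True
    then have "H \<phi> = 0" by (simp add: nrm_eq_0_iff H_carrier)
    \<comment> \<open>Rescaling to norm 1 is impossible here. Instead \<open>adj\<close> at
      \<open>k = H (?a \<phi>)\<close> and Cauchy-Schwarz bound the squared norm by 0.\<close>
    have "(nrm (H (?a \<phi>)))\<^sup>2 = Re (A (H \<phi>) (g (H (?a \<phi>))))"
      by (simp add: nrm_sq H_carrier adj)
    also have "\<dots> \<le> nrm (H \<phi>) * nrm (g (H (?a \<phi>)))"
      using inv H_carrier Cauchy_Schwarz complex_Re_le_cmod order_trans image_subset_iff by metis
    finally show ?thesis using True by simp
  next
    case False
    then have pos: "0 < nrm (H \<phi>)"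
      using nrm_nonneg[OF H_carrier, of \<phi>] by auto
    define z where "z = complex_of_real (1 / nrm (H \<phi>))"
    have "nrm (H (?a (sF z \<phi>))) \<le> c"
      using pos by (intro c) (simp add: Hs nrm_scale H_carrier z_def norm_divide)
    then show ?thesis
      using pos by (simp add: as Hs nrm_scale H_carrier z_def norm_divide field_simps)
  qed
  then have "(nrm (H (?a \<phi>)))\<^sup>2 \<le> c\<^sup>2 * (nrm (H \<phi>))\<^sup>2" for \<phi>
    unfolding power_mult_distrib[symmetric] by (intro power_mono nrm_nonneg H_carrier)
  then show ?thesis
    using kernel_le_iff[OF g] by blast
qed

text \<open>The estimate bounds \<open>pair \<phi> (g s)\<close> by a multiple of
  \<open>nrm (H \<phi>)\<close>, so Riesz gives a \<open>t\<close> in \<open>S\<close>. As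
  \<open>A (H \<phi>) t\<close> is also \<open>pair \<phi> t\<close>, non-degeneracy identifies
  \<open>t\<close> with \<open>g s\<close>.\<close>

lemma kernel_le_imp_image_subset:
  assumes g: "weak_endomorphism sE pair g"
    and le: "kernel_le pair (g \<circ> H \<circ> weak_adjoint pair g) (\<lambda>\<phi>. sE (complex_of_real \<alpha>) (H \<phi>))"
  shows "g ` S \<subseteq> S"
proof
  let ?a = "weak_adjoint pair g"
  fix y assume "y \<in> g ` S"
  then obtain s where s: "s \<in> S" and y: "y = g s" by blast
  have "cmod (pair \<phi> (g s)) \<le> (sqrt \<bar>\<alpha>\<bar> * nrm s) * nrm (H \<phi>)" for \<phi>
  proof -
    have "(nrm (H (?a \<phi>)))\<^sup>2 \<le> \<alpha> * (nrm (H \<phi>))\<^sup>2"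
      using le by (simp add: kernel_le_iff[OF g])
    \<comment> \<open>The sign of \<open>\<alpha>\<close> is unknown; the absolute value makes the
      square root below genuine.\<close>
    also have "\<dots> \<le> \<bar>\<alpha>\<bar> * (nrm (H \<phi>))\<^sup>2"
      by (intro mult_right_mono) auto
    also have "\<dots> = (sqrt \<bar>\<alpha>\<bar> * nrm (H \<phi>))\<^sup>2"
      by (simp add: power_mult_distrib)
    finally have "nrm (H (?a \<phi>)) \<le> sqrt \<bar>\<alpha>\<bar> * nrm (H \<phi>)"
      by (rule power2_le_imp_le) (simp add: nrm_nonneg H_carrier)
    then have "nrm (H (?a \<phi>)) * nrm s \<le> (sqrt \<bar>\<alpha>\<bar> * nrm (H \<phi>)) * nrm s"
      using nrm_nonneg[OF s] by (rule mult_right_mono)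
    moreover have "cmod (pair \<phi> (g s)) \<le> nrm (H (?a \<phi>)) * nrm s"
      using Cauchy_Schwarz[OF H_carrier s, of "?a \<phi>"]
      by (simp add: H_reproducing[OF s] weak_adjoint_pair[OF g])
    ultimately show ?thesis by (simp add: mult_ac)
  qed
  moreover have "Vector_Spaces.linear sF (*) (\<lambda>\<phi>. pair \<phi> (g s))"
    unfolding Vector_Spaces.linear_iff
    by (auto simp: pair_add_left pair_scale_left F.vector_space_axioms
        vector_space_over_itself.vector_space_axioms)
  ultimately obtain t where t: "t \<in> S" "\<And>\<phi>. A (H \<phi>) t = pair \<phi> (g s)"
    using riesz_on_range[OF H_linear H_carrier] by blast
  then have "g s = t"
    unfolding pair_eq_right_iff[symmetric] by (simp add: H_reproducing)
  with t y show "y \<in> S" by simp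
qed

end

theorem theorem2p6:
  fixes sE :: "complex \<Rightarrow> 'e::ab_group_add \<Rightarrow> 'e"
    and sF :: "complex \<Rightarrow> 'f::ab_group_add \<Rightarrow> 'f"
    and pair :: "'f \<Rightarrow> 'e \<Rightarrow> complex"
    and G :: "('e \<Rightarrow> 'e) set"
    and S :: "'e set" and B :: "'e \<Rightarrow> 'e \<Rightarrow> complex"
    and K H :: "'f \<Rightarrow> 'e"
  assumes "semi_duality sE sF pair"
    and "subgroup G (units_of (weak_End sE pair))"
    and "krein_subspace sE sF pair S B"
    and "kernel_of_subspace sE sF pair S B K"
    and "minimal_bound sE sF pair S B H"
  shows "invariant_under pair G S K \<longleftrightarrow>
    (\<forall>g\<in>G. g \<circ> K \<circ> weak_adjoint pair g = K) \<and>
    (\<forall>g\<in>G. \<exists>\<alpha>::real. kernel_le pair (g \<circ> H \<circ> weak_adjoint pair g)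
                                    (\<lambda>\<phi>. sE (complex_of_real \<alpha>) (H \<phi>)))"
proof -
  interpret semi_duality sE sF pair by fact
  obtain T A where min: "minimal_krein_hilbert_pair sE sF pair S B T A"
    and ker: "kernel_of_subspace sE sF pair T A H"
    using assms(5) unfolding minimal_bound_def by blast
  \<comment> \<open>Both carriers are the sum of the same subspaces \<open>P\<close> and
    \<open>N\<close>; only the sign of the form on \<open>N\<close> differs. Hence \<open>A\<close>
    makes the Krein carrier \<open>S\<close> a Hilbert space.\<close>
  have "T = S"
    using min unfolding minimal_krein_hilbert_pair_def direct_sum_form_def by auto
  moreover have "hilbert_space sE T A"
    using min unfolding minimal_krein_hilbert_pair_def hilbert_subspace_def by blast
  ultimately interpret hilbert_subspace_kernel sE sF pair S A H
    using ker by unfold_locales auto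
  \<comment> \<open>The condition on \<open>K\<close> occurs on both sides, so it remains to apply
    the two implications above to each single \<open>g\<close>.\<close>
  have "weak_endomorphism sE pair g" if "g \<in> G" for g
    using subgroup.subset[OF assms(2)] that
    by (auto simp: units_of_def Units_def weak_End_def)
  then show ?thesis
    unfolding invariant_under_def
    using image_subset_imp_kernel_le kernel_le_imp_image_subset by blast
qed

end
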